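(* Let $P=[b_1,\dots,b_N,\overline{a_1,\dots,a_k}]$ be a periodic continued fraction of type $(N,k)$ with partial quotients in $\mathbb C$. Then $P$ is strictly quasiconvergent if and only if for each $j$ with $1\le j\le k$ the limit $\hat P_j=\lim_{n\to\infty}\mathcal C_{N+j+nk}(P)$ exists in $\mathbb P^1(\mathbb C)$, and a strict majority (more than $k/2$), but not all, of $\hat P_1,\dots,\hat P_k$ are equal to one common value.
   Context: A periodic continued fraction of type $(N,k)$ ($N\ge0,k\ge1$), $P=[b_1,\dots,b_N,\overline{a_1,\dots,a_k}]$, has infinite sequence of partial quotients $c_1,c_2,\dots$ equal to $b_1,\dots,b_N,a_1,\dots,a_k,a_1,\dots,a_k,\dots$. Let $D(x)=\begin{bmatrix}x&1\\1&0\end{bmatrix}$ and $M_n(P)=D(c_1)\cdots D(c_n)$ ($M_0=I$). The $n$-th convergent is $\mathcal C_n(P)=M_n(P)_{11}/M_n(P)_{21}\in\mathbb P^1(\mathbb C)$ (with $x/0=\infty$ for $x\neq0$). $P$ converges if $\lim_{n\to\infty}\mathcal C_n(P)$ exists in $\mathbb P^1(\mathbb C)$. Let $E(P)=BAB^{-1}$ where $B=D(b_1)\cdots D(b_N)$ and $A=D(a_1)\cdots D(a_k)$. $P$ is called strictly quasiconvergent if the two eigenvalues of $E(P)$ have different absolute values and $P$ does not converge. *)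

theory Defs
  imports "HOL-Analysis.Analysis"
begin

(* The complex projective line as the one-point compactification of the plane:
   None is the point at infinity and Some z is the finite point z. *)

abbreviation P1C :: "complex option topology" where
  "P1C \<equiv> Alexandroff_compactification euclidean"

(* The pair (x, 0) with x = 0 represents no point; it never arises below, since the matrices
   involved have determinant 1 or -1. *)
definition proj_ratio :: "complex \<Rightarrow> complex \<Rightarrow> complex option" where
  "proj_ratio x y = (if y = 0 then None else Some (x / y))"

definition D :: "complex \<Rightarrow> complex^2^2" where
  "D x = vector [vector [x, 1], vector [1, 0]]"

definition D_prod :: "complex list \<Rightarrow> complex^2^2" where
  "D_prod xs = foldr (\<lambda>x X. D x ** X) xs (mat 1)"

(* A periodic continued fraction of type (N, k) is given by the list bs of its preperiodic
   partial quotients (length N) and the list as of its periodic ones (length k, with k > 0).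
   partial_quotient bs as n is the n-th partial quotient, counted from n = 1. *)
definition partial_quotient :: "complex list \<Rightarrow> complex list \<Rightarrow> nat \<Rightarrow> complex" where
  "partial_quotient bs as n =
     (if n \<le> length bs then bs ! (n - 1) else as ! ((n - 1 - length bs) mod length as))"

definition pcf_matrix :: "complex list \<Rightarrow> complex list \<Rightarrow> nat \<Rightarrow> complex^2^2" where
  "pcf_matrix bs as n = D_prod (map (partial_quotient bs as) [1..<Suc n])"

definition convergent_of :: "complex list \<Rightarrow> complex list \<Rightarrow> nat \<Rightarrow> complex option" where
  "convergent_of bs as n =
     proj_ratio (pcf_matrix bs as n $ 1 $ 1) (pcf_matrix bs as n $ 2 $ 1)"

definition pcf_converges :: "complex list \<Rightarrow> complex list \<Rightarrow> bool" where
  "pcf_converges bs as \<longleftrightarrow> (\<exists>l. limitin P1C (convergent_of bs as) l sequentially)"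

definition pcf_E :: "complex list \<Rightarrow> complex list \<Rightarrow> complex^2^2" where
  "pcf_E bs as = D_prod bs ** D_prod as ** matrix_inv (D_prod bs)"

definition is_eigenvalue :: "complex^'n^'n \<Rightarrow> complex \<Rightarrow> bool" where
  "is_eigenvalue A z \<longleftrightarrow> (\<exists>v. v \<noteq> 0 \<and> A *v v = z *s v)"

(* A 2 by 2 matrix has at most two distinct eigenvalues, so z and w below are necessarily
   the two eigenvalues of the matrix. *)
definition strictly_quasiconvergent :: "complex list \<Rightarrow> complex list \<Rightarrow> bool" where
  "strictly_quasiconvergent bs as \<longleftrightarrow>
     (\<exists>z w. is_eigenvalue (pcf_E bs as) z \<and> is_eigenvalue (pcf_E bs as) w \<and> cmod z \<noteq> cmod w)
     \<and> \<not> pcf_converges bs as"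

end

theory Submission
  imports Defs
begin

text \<open>Write $v_j$ for the first column of $M_{N+j}$. Then $E v_j = v_{j+k}$, so the convergents with
  index $N+j+nk$ form the orbit of $[v_j]$ under $E$, and $\det(v_{j+1}, v_j) = \pm 1$, so that cyclically
  adjacent $v_j$ are never parallel.

  If the eigenvalues of $E$ have different moduli, all orbits tend to the attracting fixed point except
  those starting at the repelling one, which happens for at most half of the indices. Exactly half would
  force every other $v_j$ to be the same vector (the recurrence $v_{j+2} = c v_{j+1} + v_j$ then has
  $c = 0$), hence $E v_j = v_j$ with $\det E = 1$, and both eigenvalues would be $1$.

  Conversely, a strict majority yields two cyclically adjacent indices with the same limit. If both
  eigenvalues have modulus $1$ and $E$ is diagonalizable, orbits of vectors are bounded while
  the determinant of two orbits has constant modulus, so independent vectors cannot have a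
  common limit; if $E$ is not diagonalizable, all limits coincide.\<close>

section \<open>Limits in the one-point compactification\<close>

text \<open>The basic neighbourhoods of infinity are the complements of closed compact sets, and in
  a metric space compactness already gives closedness.\<close>

lemma limitin_Alexandroff_None:
  fixes f :: "nat \<Rightarrow> 'a::heine_borel option"
  shows "limitin (Alexandroff_compactification euclidean) f None sequentially \<longleftrightarrow>
    (\<forall>K. compact K \<longrightarrow> (\<forall>\<^sub>F n in sequentially. f n \<notin> Some ` K))"
proof -
  have *: "x \<in> insert None (Some ` (UNIV - C)) \<longleftrightarrow> x \<notin> Some ` C" for x and C :: "'a set"
    by (cases x) auto
  show ?thesis
  proof safe
    fix K :: "'a set"
    assume L: "limitin (Alexandroff_compactification euclidean) f None sequentially" and K: "compact K"
    have "openin (Alexandroff_compactification euclidean) (insert None (Some ` (UNIV - K)))"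
      unfolding openin_Alexandroff_compactification using K compact_imp_closed[OF K]
      by (intro disjI2 exI[of _ K]) simp
    then have "\<forall>\<^sub>F n in sequentially. f n \<in> insert None (Some ` (UNIV - K))"
      using L unfolding limitin_def by blast
    then show "\<forall>\<^sub>F n in sequentially. f n \<notin> Some ` K"
      unfolding * .
  next
    assume R: "\<forall>K. compact K \<longrightarrow> (\<forall>\<^sub>F n in sequentially. f n \<notin> Some ` K)"
    have "\<forall>\<^sub>F n in sequentially. f n \<in> U"
      if U: "openin (Alexandroff_compactification euclidean) U" "None \<in> U" for U
    proof -
      obtain C where "compact C" "U = insert None (Some ` (UNIV - C))"
        using U by (auto simp: openin_Alexandroff_compactification)
      then show ?thesis
        using R by (simp only: *)
    qed
    then show "limitin (Alexandroff_compactification euclidean) f None sequentially"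
      by (simp add: limitin_def)
  qed
qed

text \<open>\<open>Some\<close> is an open embedding, so the images of balls form a neighbourhood
  base at a finite point.\<close>

lemma limitin_Alexandroff_Some:
  fixes f :: "nat \<Rightarrow> 'a::metric_space option"
  shows "limitin (Alexandroff_compactification euclidean) f (Some w) sequentially \<longleftrightarrow>
    (\<forall>e>0. \<forall>\<^sub>F n in sequentially. f n \<in> Some ` ball w e)"
proof safe
  fix e :: real assume "e > 0" and L: "limitin (Alexandroff_compactification euclidean) f (Some w) sequentially"
  then show "\<forall>\<^sub>F n in sequentially. f n \<in> Some ` ball w e"
    unfolding limitin_def by (force simp: openin_Alexandroff_compactification_image_Some)
next
  assume R: "\<forall>e>0. \<forall>\<^sub>F n in sequentially. f n \<in> Some ` ball w e"
  have "\<forall>\<^sub>F n in sequentially. f n \<in> U"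
    if U: "openin (Alexandroff_compactification euclidean) U" "Some w \<in> U" for U
  proof -
    have "open (Some -` U)"
      using openin_continuous_map_preimage[OF continuous_map_Some U(1)]
      by (simp add: vimage_def)
    then obtain e where e: "e > 0" "ball w e \<subseteq> Some -` U"
      using U(2) by (metis open_contains_ball vimageI)
    show ?thesis
      using R[rule_format, OF e(1)] by eventually_elim (use e(2) in auto)
  qed
  then show "limitin (Alexandroff_compactification euclidean) f (Some w) sequentially"
    by (auto simp: limitin_def)
qed

lemma Hausdorff_space_P1C: "Hausdorff_space P1C"
  by (simp add: Hausdorff_space_Alexandroff_compactification locally_compact_space_euclidean)

section \<open>Homogeneous coordinates on the projective line\<close>

text \<open>The standard area form. It vanishes exactly on parallel pairs, so it compares projective
  points without singling out infinity.\<close>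

definition det2 :: "complex^2 \<Rightarrow> complex^2 \<Rightarrow> complex" where
  "det2 x y = x $ 1 * y $ 2 - x $ 2 * y $ 1"

definition proj_point :: "complex^2 \<Rightarrow> complex option" where
  "proj_point x = proj_ratio (x $ 1) (x $ 2)"

lemma vec2_eq_iff: "x = y \<longleftrightarrow> x $ 1 = y $ 1 \<and> x $ 2 = y $ 2" for x y :: "'a^2"
  by (simp add: vec_eq_iff forall_2)

lemma det2_simps [simp]:
  "det2 x x = 0" "det2 0 x = 0" "det2 x 0 = 0"
  "det2 (x + y) z = det2 x z + det2 y z" "det2 (x - y) z = det2 x z - det2 y z"
  "det2 (c *s x) z = c * det2 x z"
  "det2 z (x + y) = det2 z x + det2 z y" "det2 z (c *s x) = c * det2 z x"
  by (simp_all add: det2_def algebra_simps)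

lemma det2_commute: "det2 x y = - det2 y x"
  by (simp add: det2_def)

lemma det2_matrix: "det2 (A *v x) (A *v y) = det A * det2 x y"
  by (simp add: det2_def det_2 matrix_vector_mult_def sum_2 algebra_simps)

text \<open>Cramer's rule with the denominator cleared, a polynomial identity in the
  coordinates.\<close>

lemma det2_expand: "det2 p q *s x = det2 x q *s p + det2 p x *s q"
  by (simp add: vec2_eq_iff det2_def algebra_simps)

lemma det2_decompose:
  assumes "det2 p q \<noteq> 0"
  shows "x = (det2 x q / det2 p q) *s p + (det2 p x / det2 p q) *s q"
proof -
  have "x = (1 / det2 p q) *s (det2 p q *s x)" using assms by (simp add: vec2_eq_iff)
  also have "\<dots> = (1 / det2 p q) *s (det2 x q *s p + det2 p x *s q)"
    by (rule arg_cong[OF det2_expand])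
  also have "\<dots> = (det2 x q / det2 p q) *s p + (det2 p x / det2 p q) *s q"
    by (simp add: vec2_eq_iff ring_distribs)
  finally show ?thesis .
qed

lemma det2_zero_iff:
  assumes "p \<noteq> 0"
  shows "det2 x p = 0 \<longleftrightarrow> (\<exists>c. x = c *s p)"
proof
  assume 0: "det2 x p = 0"
  show "\<exists>c. x = c *s p"
  proof (cases "p $ 1 = 0")
    case True
    then have "p $ 2 \<noteq> 0" using assms by (auto simp: vec2_eq_iff)
    with True 0 have "x = (x $ 2 / p $ 2) *s p"
      by (auto simp: vec2_eq_iff det2_def)
    then show ?thesis ..
  next
    case False
    with 0 have "x = (x $ 1 / p $ 1) *s p"
      by (auto simp: vec2_eq_iff det2_def field_simps)
    then show ?thesis ..
  qed
qed auto

lemma proj_point_eq_iff: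
  assumes "x \<noteq> 0" "y \<noteq> 0"
  shows "proj_point x = proj_point y \<longleftrightarrow> det2 x y = 0"
  using assms
  by (auto simp: proj_point_def proj_ratio_def det2_def vec2_eq_iff field_simps)

lemma proj_point_surj: obtains y where "y \<noteq> 0" "proj_point y = l"
proof (cases l)
  case None
  show ?thesis
    by (rule that[of "vector [1, 0]"]) (auto simp: None proj_point_def proj_ratio_def vec2_eq_iff)
next
  case (Some z)
  show ?thesis
    by (rule that[of "vector [z, 1]"]) (auto simp: Some proj_point_def proj_ratio_def vec2_eq_iff)
qed

section \<open>Projective convergence in homogeneous coordinates\<close>

definition norm1 :: "complex^2 \<Rightarrow> real" where
  "norm1 x = cmod (x $ 1) + cmod (x $ 2)"

lemma norm1_pos: "x \<noteq> 0 \<Longrightarrow> norm1 x > 0"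
  by (auto simp: norm1_def vec2_eq_iff add_pos_nonneg add_nonneg_pos)

lemma norm1_scale: "norm1 (c *s x) = cmod c * norm1 x"
  by (simp add: norm1_def norm_mult algebra_simps)

lemma norm1_triangle: "norm1 (x + y) \<le> norm1 x + norm1 y"
  unfolding norm1_def using norm_triangle_ineq[of "x$1" "y$1"] norm_triangle_ineq[of "x$2" "y$2"] by simp

text \<open>Up to bounded factors the quotient is the chordal distance between the points of
  \<open>x n\<close> and \<open>y\<close>. Convergence in the compactification thus becomes a
  statement about a null sequence of reals, in the same form for finite and infinite limits.\<close>

lemma limitin_P1C_iff:
  assumes x: "\<And>n. x n \<noteq> 0" and y: "y \<noteq> 0"
  shows "limitin P1C (\<lambda>n. proj_point (x n)) (proj_point y) sequentially \<longleftrightarrow>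
    (\<lambda>n. cmod (det2 (x n) y) / norm1 (x n)) \<longlonglongrightarrow> 0" (is "?lim \<longleftrightarrow> ?r \<longlonglongrightarrow> 0")
proof -
  have r: "?r \<longlonglongrightarrow> 0 \<longleftrightarrow> (\<forall>e>0. \<forall>\<^sub>F n in sequentially. cmod (det2 (x n) y) < e * norm1 (x n))"
  proof -
    have "dist (?r n) 0 < e \<longleftrightarrow> cmod (det2 (x n) y) < e * norm1 (x n)" for n e
      using norm1_pos[OF x, of n] by (simp add: pos_divide_less_eq)
    then show ?thesis
      unfolding tendsto_iff by simp
  qed
  show ?thesis
  proof (cases "y $ 2 = 0")
    case True
    then have y1: "y $ 1 \<noteq> 0" using y by (auto simp: vec2_eq_iff)
    have d: "cmod (det2 (x n) y) = cmod (x n $ 2) * cmod (y $ 1)" for n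
      by (simp add: det2_def True norm_mult)
    have py: "proj_point y = None" by (simp add: proj_point_def proj_ratio_def True)
    show ?thesis
    proof
      assume L: ?lim
      show "?r \<longlonglongrightarrow> 0"
        unfolding r
      proof safe
        fix e :: real assume e: "e > 0"
        \<comment> \<open>Outside this radius the quotient of the coordinates of \<open>x n\<close>
          exceeds \<open>cmod (y $ 1) / e\<close>, which is the wanted bound after clearing
          denominators.\<close>
        have "\<forall>\<^sub>F n in sequentially. proj_point (x n) \<notin> Some ` cball 0 (cmod (y $ 1) / e)"
          using L[unfolded py limitin_Alexandroff_None, rule_format, OF compact_cball] .
        then show "\<forall>\<^sub>F n in sequentially. cmod (det2 (x n) y) < e * norm1 (x n)"
        proof eventually_elim
          case (elim n)
          show ?case
          proof (cases "x n $ 2 = 0")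
            case True
            then show ?thesis using e norm1_pos[OF x[of n]] by (simp add: d)
          next
            case False
            then have "cmod (x n $ 1 / x n $ 2) > cmod (y $ 1) / e"
              using elim by (auto simp: proj_point_def proj_ratio_def)
            then have "cmod (y $ 1) * cmod (x n $ 2) < e * cmod (x n $ 1)"
              using False e by (simp add: norm_divide field_simps)
            also have "\<dots> \<le> e * norm1 (x n)" using e by (simp add: norm1_def)
            finally show ?thesis by (simp add: d mult.commute)
          qed
        qed
      qed
    next
      assume "?r \<longlonglongrightarrow> 0"
      note R = this[unfolded r]
      show ?lim
        unfolding py limitin_Alexandroff_None
      proof safe
        fix K :: "complex set" assume "compact K"
        then obtain B where B: "B > 0" "\<And>z. z \<in> K \<Longrightarrow> cmod z \<le> B"
          by (metis compact_imp_bounded bounded_pos)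
        \<comment> \<open>The extra 1 pays for the summand \<open>cmod (x n $ 2)\<close> of
          \<open>norm1 (x n)\<close>, so that \<open>B * cmod (x n $ 2) < cmod (x n $ 1)\<close>
          remains.\<close>
        have "cmod (y $ 1) / (B + 1) > 0" using y1 B(1) by simp
        from R[rule_format, OF this]
        show "\<forall>\<^sub>F n in sequentially. proj_point (x n) \<notin> Some ` K"
        proof eventually_elim
          case (elim n)
          then have "cmod (x n $ 2) * cmod (y $ 1) < norm1 (x n) / (B + 1) * cmod (y $ 1)"
            by (simp add: d mult.commute)
          then have "cmod (x n $ 2) < norm1 (x n) / (B + 1)"
            using y1 mult_less_cancel_right_pos zero_less_norm_iff by blast
          then have "(B + 1) * cmod (x n $ 2) < norm1 (x n)"
            using B(1) by (simp add: pos_less_divide_eq mult.commute)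
          then have *: "B * cmod (x n $ 2) < cmod (x n $ 1)"
            by (simp add: norm1_def algebra_simps)
          show ?case
          proof
            assume "proj_point (x n) \<in> Some ` K"
            then have "x n $ 2 \<noteq> 0" "x n $ 1 / x n $ 2 \<in> K"
              by (auto simp: proj_point_def proj_ratio_def split: if_splits)
            with B(2)[of "x n $ 1 / x n $ 2"] * show False
              by (simp add: norm_divide field_simps)
          qed
        qed
      qed
    qed
  next
    case False
    define w where "w = y $ 1 / y $ 2"
    have py: "proj_point y = Some w" by (simp add: proj_point_def proj_ratio_def False w_def)
    have d: "cmod (det2 (x n) y) = cmod (y $ 2) * cmod (x n $ 1 - w * x n $ 2)" for n
    proof -
      have "det2 (x n) y = y $ 2 * (x n $ 1 - w * x n $ 2)"
        using False by (simp add: det2_def w_def right_diff_distrib)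
      then show ?thesis by (simp add: norm_mult)
    qed
    show ?thesis
    proof
      assume L: ?lim
      show "?r \<longlonglongrightarrow> 0"
        unfolding r
      proof safe
        fix e :: real assume e: "e > 0"
        then have "e / cmod (y $ 2) > 0" using False by simp
        then have "\<forall>\<^sub>F n in sequentially. proj_point (x n) \<in> Some ` ball w (e / cmod (y $ 2))"
          using L[unfolded py limitin_Alexandroff_Some, rule_format] by simp
        then show "\<forall>\<^sub>F n in sequentially. cmod (det2 (x n) y) < e * norm1 (x n)"
        proof eventually_elim
          case (elim n)
          then have n2: "x n $ 2 \<noteq> 0" and *: "cmod (x n $ 1 / x n $ 2 - w) < e / cmod (y $ 2)"
            by (auto simp: proj_point_def proj_ratio_def dist_norm norm_minus_commute split: if_splits)
          have eq: "x n $ 1 - w * x n $ 2 = (x n $ 1 / x n $ 2 - w) * x n $ 2"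
            using n2 by (simp add: left_diff_distrib)
          have "cmod (det2 (x n) y) = cmod (y $ 2) * cmod (x n $ 1 / x n $ 2 - w) * cmod (x n $ 2)"
            unfolding d eq norm_mult by (simp only: mult.assoc)
          also have "\<dots> < e * cmod (x n $ 2)"
            using * False n2 by (intro mult_strict_right_mono) (simp_all add: pos_less_divide_eq mult.commute)
          finally have "cmod (det2 (x n) y) < e * cmod (x n $ 2)" .
          also have "\<dots> \<le> e * norm1 (x n)" using e by (simp add: norm1_def)
          finally show ?case .
        qed
      qed
    next
      assume "?r \<longlonglongrightarrow> 0"
      note R = this[unfolded r]
      show ?lim
        unfolding py limitin_Alexandroff_Some
      proof safe
        fix e :: real assume e: "e > 0"
        \<comment> \<open>\<open>h\<close> is the solution of
          \<open>h * (1 + cmod w) = (1 - h) * e\<close>: the bound \<open>h * norm1 (x n)\<close>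
          produces a term \<open>h * a\<close>, which is absorbed on the left since
          \<open>h < 1\<close>.\<close>
        define h where "h = e / (1 + cmod w + e)"
        have D: "1 + cmod w + e > 0" using e norm_ge_zero[of w] by linarith
        have hD: "h * (1 + cmod w + e) = e" unfolding h_def using D by simp
        have h: "h > 0" "h < 1"
          unfolding h_def using e D norm_ge_zero[of w]
          by (simp_all only: divide_pos_pos divide_less_eq_1_pos)
        have hw: "h * (1 + cmod w) = (1 - h) * e"
          using hD by (simp add: algebra_simps)
        have "cmod (y $ 2) * h > 0" using False h by simp
        from R[rule_format, OF this]
        show "\<forall>\<^sub>F n in sequentially. proj_point (x n) \<in> Some ` ball w e"
        proof eventually_elim
          case (elim n)
          define a where "a = cmod (x n $ 1 - w * x n $ 2)"
          have "a < h * norm1 (x n)" using elim False by (simp add: d a_def)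
          also have "norm1 (x n) \<le> (a + cmod w * cmod (x n $ 2)) + cmod (x n $ 2)"
            using norm_triangle_ineq[of "x n $ 1 - w * x n $ 2" "w * x n $ 2"]
            by (simp add: norm1_def a_def norm_mult)
          finally have "a < h * (a + cmod w * cmod (x n $ 2) + cmod (x n $ 2))"
            using h by simp
          then have "(1 - h) * a < (h * (1 + cmod w)) * cmod (x n $ 2)"
            by (simp add: algebra_simps)
          then have *: "a < e * cmod (x n $ 2)" using h unfolding hw by simp
          then have n2: "x n $ 2 \<noteq> 0" by (auto simp: a_def)
          have eq: "x n $ 1 - w * x n $ 2 = (x n $ 1 / x n $ 2 - w) * x n $ 2"
            using n2 by (simp add: left_diff_distrib)
          have "cmod (x n $ 1 / x n $ 2 - w) < e"
            using * n2 unfolding a_def eq norm_mult by simp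
          then show ?case using n2
            by (auto simp: proj_point_def proj_ratio_def dist_norm norm_minus_commute)
        qed
      qed
    qed
  qed
qed

text \<open>The quotient in \<open>limitin_P1C_iff\<close> does not change when \<open>x n\<close>
  is scaled, and it is continuous at \<open>y\<close> with value 0 there. The factor may vanish for
  finitely many \<open>n\<close>, which admits factors with a division by \<open>n\<close>.\<close>

lemma limitin_P1C_rescaled:
  assumes x: "\<And>n. x n \<noteq> 0" and y: "y \<noteq> 0"
    and c: "\<forall>\<^sub>F n in sequentially. c n \<noteq> 0" and lim: "(\<lambda>n. c n *s x n) \<longlonglongrightarrow> y"
  shows "limitin P1C (\<lambda>n. proj_point (x n)) (proj_point y) sequentially"
proof -
  have "(\<lambda>n. cmod (det2 (c n *s x n) y) / norm1 (c n *s x n)) \<longlonglongrightarrow> cmod (det2 y y) / norm1 y"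
    unfolding det2_def norm1_def
    by (intro tendsto_intros tendsto_vec_nth[OF lim])
       (use norm1_pos[OF y] in \<open>simp add: norm1_def\<close>)
  moreover have "\<forall>\<^sub>F n in sequentially.
     cmod (det2 (c n *s x n) y) / norm1 (c n *s x n) = cmod (det2 (x n) y) / norm1 (x n)"
    using c by eventually_elim (simp add: norm1_scale norm_mult)
  ultimately show ?thesis
    unfolding limitin_P1C_iff[OF x y] by (simp add: filterlim_cong)
qed

text \<open>If both sequences tended to the point of \<open>y\<close>, boundedness would send
  \<open>det2 (u n) y\<close> and \<open>det2 (v n) y\<close> to 0. Expanding \<open>y\<close> in
  \<open>u n\<close> and \<open>v n\<close> would then bound the positive number
  \<open>c * norm1 y\<close> by a null sequence.\<close>

lemma no_common_limit:
  assumes K: "\<And>n. norm1 (u n) \<le> K" "\<And>n. norm1 (v n) \<le> K"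
    and c: "\<And>n. cmod (det2 (u n) (v n)) = c" "c > 0"
    and l: "limitin P1C (\<lambda>n. proj_point (u n)) l sequentially" "limitin P1C (\<lambda>n. proj_point (v n)) l sequentially"
  shows False
proof -
  obtain y where y: "y \<noteq> 0" "proj_point y = l" by (rule proj_point_surj)
  have nz: "u n \<noteq> 0" "v n \<noteq> 0" for n using c(1)[of n] c(2) by auto
  have to0: "(\<lambda>n. cmod (det2 (x n) y)) \<longlonglongrightarrow> 0"
    if "\<And>n. norm1 (x n) \<le> K" "\<And>n. x n \<noteq> 0" "limitin P1C (\<lambda>n. proj_point (x n)) l sequentially" for x
  proof (rule Lim_null_comparison)
    have "(\<lambda>n. cmod (det2 (x n) y) / norm1 (x n)) \<longlonglongrightarrow> 0"
      using that(3) limitin_P1C_iff[OF that(2) y(1)] y(2) by simp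
    then show "(\<lambda>n. cmod (det2 (x n) y) / norm1 (x n) * K) \<longlonglongrightarrow> 0"
      by (rule tendsto_mult_left_zero)
    show "\<forall>\<^sub>F n in sequentially. norm (cmod (det2 (x n) y)) \<le> cmod (det2 (x n) y) / norm1 (x n) * K"
    proof (intro always_eventually allI)
      fix n
      have "cmod (det2 (x n) y) = cmod (det2 (x n) y) / norm1 (x n) * norm1 (x n)"
        using norm1_pos[OF that(2)[of n]] by simp
      also have "\<dots> \<le> cmod (det2 (x n) y) / norm1 (x n) * K"
        using that(1) norm1_pos[OF that(2)[of n]] by (intro mult_left_mono) auto
      finally show "norm (cmod (det2 (x n) y)) \<le> cmod (det2 (x n) y) / norm1 (x n) * K" by simp
    qed
  qed
  have "c * norm1 y \<le> (cmod (det2 (v n) y) + cmod (det2 (u n) y)) * K" for n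
  proof -
    have "c * norm1 y = norm1 (det2 (u n) (v n) *s y)" by (simp add: norm1_scale c)
    also have "\<dots> = norm1 (det2 y (v n) *s u n + det2 (u n) y *s v n)" by (rule arg_cong[OF det2_expand])
    also have "\<dots> \<le> cmod (det2 y (v n)) * norm1 (u n) + cmod (det2 (u n) y) * norm1 (v n)"
      using norm1_triangle[of "det2 y (v n) *s u n" "det2 (u n) y *s v n"] by (simp add: norm1_scale)
    also have "\<dots> \<le> cmod (det2 y (v n)) * K + cmod (det2 (u n) y) * K"
      by (intro add_mono mult_left_mono K) auto
    finally show ?thesis by (simp add: det2_commute[of y] algebra_simps)
  qed
  moreover have "(\<lambda>n. (cmod (det2 (v n) y) + cmod (det2 (u n) y)) * K) \<longlonglongrightarrow> (0 + 0) * K"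
    by (intro tendsto_intros to0 K nz l)
  ultimately have "c * norm1 y \<le> 0"
    using LIMSEQ_le_const[of "\<lambda>n. (cmod (det2 (v n) y) + cmod (det2 (u n) y)) * K" "(0 + 0) * K"]
    by simp
  with c(2) norm1_pos[OF y(1)] show False
    by (simp add: mult_le_0_iff)
qed

section \<open>Orbits and normal forms of 2 by 2 matrices\<close>

definition orbit :: "complex^2^2 \<Rightarrow> complex^2 \<Rightarrow> nat \<Rightarrow> complex^2" where
  "orbit M x n = (((*v) M) ^^ n) x"

lemma orbit_0 [simp]: "orbit M x 0 = x"
  and orbit_Suc [simp]: "orbit M x (Suc n) = M *v orbit M x n"
  by (simp_all add: orbit_def)

lemma det2_orbit: "det2 (orbit M x n) (orbit M y n) = det M ^ n * det2 x y"
  by (induction n) (simp_all add: det2_matrix)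

lemma det2_complement:
  assumes "x \<noteq> 0" obtains y where "det2 x y \<noteq> 0"
proof (cases "x $ 1 = 0")
  case True
  then show ?thesis using assms that[of "vector [1, 0]"] by (auto simp: det2_def vec2_eq_iff)
next
  case False
  then show ?thesis using that[of "vector [0, 1]"] by (auto simp: det2_def)
qed

lemma orbit_nonzero:
  assumes "det M \<noteq> 0" "x \<noteq> 0" shows "orbit M x n \<noteq> 0"
proof
  assume "orbit M x n = 0"
  obtain y where "det2 x y \<noteq> 0" using det2_complement assms by blast
  with det2_orbit[of M x n y] \<open>orbit M x n = 0\<close> assms show False by simp
qed

lemma orbit_eigenbasis:
  assumes "M *v p = l *s p" "M *v q = m *s q"
  shows "orbit M (a *s p + b *s q) n = (a * l ^ n) *s p + (b * m ^ n) *s q"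
  by (induction n)
     (simp_all add: assms matrix_vector_right_distrib vec.scale algebra_simps)

text \<open>The power formula for a Jordan block; the factor \<open>l\<close> on the left avoids the
  exponent \<open>n - 1\<close> at \<open>n = 0\<close>.\<close>

lemma orbit_jordan:
  assumes "M *v p = l *s p" "M *v x = l *s x + g *s p"
  shows "l *s orbit M x n = l ^ Suc n *s x + (of_nat n * l ^ n * g) *s p"
proof (induction n)
  case (Suc n)
  have "l *s orbit M x (Suc n) = M *v (l *s orbit M x n)"
    by (simp add: vec.scale)
  also have "\<dots> = l ^ Suc (Suc n) *s x + (of_nat (Suc n) * l ^ Suc n * g) *s p"
    unfolding Suc by (simp add: assms matrix_vector_right_distrib vec.scale vec2_eq_iff algebra_simps)
  finally show ?case .
qed simp

lemma det_eigenbasis: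
  assumes "M *v p = l *s p" "M *v q = m *s q" "det2 p q \<noteq> 0"
  shows "det M = l * m"
proof -
  have "det M * det2 p q = l * m * det2 p q"
    unfolding det2_matrix[symmetric] by (simp add: assms(1,2))
  then show ?thesis using assms(3) by simp
qed

lemma eigenvectors_independent:
  assumes "M *v p = l *s p" "M *v q = m *s q" "p \<noteq> 0" "q \<noteq> 0" "l \<noteq> m"
  shows "det2 p q \<noteq> 0"
proof
  assume "det2 p q = 0"
  then obtain c where c: "p = c *s q" using det2_zero_iff assms(4) by blast
  have "l *s p = c *s (m *s q)"
    using assms(1,2) c by (metis vec.scale)
  also have "\<dots> = m *s p"
    by (simp add: c mult.commute)
  finally have "l *s p = m *s p" .
  with assms(3,5) show False by (simp add: vec2_eq_iff)
qed

lemma eigenvalue_exists: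
  fixes M :: "complex^2^2"
  obtains p l where "p \<noteq> 0" "M *v p = l *s p"
proof -
  \<comment> \<open>\<open>l\<close> comes from the quadratic formula for the characteristic
    polynomial, with trace \<open>t\<close>.\<close>
  define t where "t = M$1$1 + M$2$2"
  define s where "s = csqrt (t^2 - 4 * det M)"
  define l where "l = (t + s) / 2"
  have "(2 * l - t)^2 = t^2 - 4 * det M"
  proof -
    have "2 * l - t = s" by (simp add: l_def field_simps)
    then show ?thesis by (simp add: s_def)
  qed
  then have "4 * ((M$1$1 - l) * (M$2$2 - l)) = 4 * (M$1$2 * M$2$1)"
    by (simp add: t_def det_2 power2_eq_square algebra_simps)
  then have char: "(M$1$1 - l) * (M$2$2 - l) = M$1$2 * M$2$1"
    by simp
  have apply_l: "M *v p = l *s p"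
    if "(M$1$1 - l) * p$1 + M$1$2 * p$2 = 0" "M$2$1 * p$1 + (M$2$2 - l) * p$2 = 0" for p
    using that by (simp add: vec2_eq_iff matrix_vector_mult_def sum_2 algebra_simps)
  show ?thesis
  proof (cases "M$1$2 = 0 \<and> M$1$1 = l")
    case False
    \<comment> \<open>This vector is annihilated by the first row of \<open>M - l\<close>; the
      second row follows from \<open>char\<close>.\<close>
    show ?thesis
      by (rule that[of "vector [M$1$2, l - M$1$1]", OF _ apply_l])
         (use False char in \<open>auto simp: vec2_eq_iff algebra_simps\<close>)
  next
    case True
    note T = this
    show ?thesis
    proof (cases "M$2$1 = 0 \<and> M$2$2 = l")
      case False
      \<comment> \<open>The first row of \<open>M - l\<close> is zero here, so only the second row
        imposes a condition.\<close>
      show ?thesis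
        by (rule that[of "vector [M$2$2 - l, - M$2$1]", OF _ apply_l])
           (use T False in \<open>auto simp: vec2_eq_iff algebra_simps\<close>)
    next
      case True
      show ?thesis
        by (rule that[of "vector [1, 0]", OF _ apply_l])
           (use T True in \<open>auto simp: vec2_eq_iff\<close>)
    qed
  qed
qed

text \<open>In a basis formed by an eigenvector \<open>p\<close> and any complement,
  \<open>M\<close> is upper triangular. The second case avoids a basis: \<open>M - l\<close> sends
  every vector to a multiple of \<open>p\<close>, with multiple 0 only on the line of
  \<open>p\<close>. In this form it applies to any starting vector of an orbit.\<close>

lemma jordan_form_2:
  fixes M :: "complex^2^2"
  obtains (diagonalizable) p q l m where "det2 p q \<noteq> 0" "M *v p = l *s p" "M *v q = m *s q"
  | (jordan) p l where "p \<noteq> 0" "M *v p = l *s p"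
      "\<And>x. \<exists>g. M *v x = l *s x + g *s p \<and> (g = 0 \<longrightarrow> det2 x p = 0)"
proof -
  obtain p l where p: "p \<noteq> 0" "M *v p = l *s p" by (rule eigenvalue_exists)
  obtain r where r: "det2 p r \<noteq> 0" using det2_complement p(1) by blast
  have decomp: "\<exists>a b. x = a *s p + b *s r" for x
    using det2_decompose[OF r] by blast
  obtain n m where nm: "M *v r = n *s p + m *s r" using decomp by blast
  show ?thesis
  proof (cases "l = m")
    case False
    \<comment> \<open>The coefficient \<open>c\<close> of \<open>p\<close> solves
      \<open>n + c * l = m * c\<close>, which makes \<open>q\<close> an eigenvector for
      \<open>m\<close>.\<close>
    define q where "q = r + (n / (m - l)) *s p"
    have "n + (n / (m - l)) * l = m * (n / (m - l))"
      using False by (simp add: divide_simps) (simp add: algebra_simps)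
    then have e: "(n + (n / (m - l)) * l) *s p = (m * (n / (m - l))) *s p" by simp
    have "M *v q = (n + (n / (m - l)) * l) *s p + m *s r"
      by (simp add: q_def matrix_vector_right_distrib vec.scale p nm vec2_eq_iff algebra_simps)
    also have "\<dots> = m *s q"
      unfolding e by (simp add: q_def vec2_eq_iff algebra_simps)
    finally have "M *v q = m *s q" .
    moreover have "det2 p q \<noteq> 0" using r by (simp add: q_def)
    ultimately show ?thesis using diagonalizable p by blast
  next
    case True
    show ?thesis
    proof (cases "n = 0")
      case True
      then have "M *v r = m *s r" using nm by simp
      then show ?thesis by (rule diagonalizable[OF r p(2)])
    next
      case False
      show ?thesis
      proof (rule jordan[OF p])
        fix x
        obtain a b where x: "x = a *s p + b *s r" using decomp by blast
        have "M *v x = l *s x + (b * n) *s p"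
          by (simp add: x True matrix_vector_right_distrib vec.scale p nm vec2_eq_iff algebra_simps)
        moreover have "b * n = 0 \<longrightarrow> det2 x p = 0"
          using False x by simp
        ultimately show "\<exists>g. M *v x = l *s x + g *s p \<and> (g = 0 \<longrightarrow> det2 x p = 0)" by blast
      qed
    qed
  qed
qed

section \<open>Limits and bounds of orbits\<close>

text \<open>The condition on \<open>x\<close> says that its \<open>p\<close>-coordinate
  \<open>a\<close> is nonzero. Dividing the orbit by \<open>a * l ^ n\<close> leaves
  \<open>p\<close> plus a multiple of \<open>(m / l) ^ n *s q\<close>, which vanishes in the
  limit.\<close>

lemma orbit_attracted:
  assumes pq: "M *v p = l *s p" "M *v q = m *s q" "det2 p q \<noteq> 0"
    and lm: "cmod m < cmod l" "m \<noteq> 0" and x: "det2 x q \<noteq> 0"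
  shows "limitin P1C (\<lambda>n. proj_point (orbit M x n)) (proj_point p) sequentially"
proof (rule limitin_P1C_rescaled)
  have l0: "l \<noteq> 0" using lm by auto
  have "det M \<noteq> 0" using det_eigenbasis[OF pq] l0 lm by simp
  then show "orbit M x n \<noteq> 0" for n using x by (intro orbit_nonzero) auto
  show "p \<noteq> 0" using pq(3) by auto
  define a b where "a = det2 x q / det2 p q" and "b = det2 p x / det2 p q"
  have a0: "a \<noteq> 0" using x pq(3) by (simp add: a_def)
  have xab: "x = a *s p + b *s q"
    unfolding a_def b_def by (rule det2_decompose[OF pq(3)])
  let ?c = "\<lambda>n. 1 / (a * l ^ n)"
  show "\<forall>\<^sub>F n in sequentially. ?c n \<noteq> 0" using l0 a0 by simp
  have "?c n *s orbit M x n = p + ((b / a) * (m / l) ^ n) *s q" for n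
    unfolding xab orbit_eigenbasis[OF pq(1,2)]
    using l0 a0 by (simp add: vec2_eq_iff field_simps)
  moreover have pw: "(\<lambda>n. (m / l) ^ n) \<longlonglongrightarrow> 0"
  proof (rule LIMSEQ_power_zero)
    show "cmod (m / l) < 1" using lm l0 by (simp add: norm_divide)
  qed
  then have "(\<lambda>n. p $ i + ((b / a) * (m / l) ^ n) * q $ i) \<longlonglongrightarrow> p $ i + ((b / a) * 0) * q $ i" for i
    by (intro tendsto_add tendsto_mult tendsto_const pw)
  then have "(\<lambda>n. p + ((b / a) * (m / l) ^ n) *s q) \<longlonglongrightarrow> p"
    by (intro vec_tendstoI) simp
  ultimately show "(\<lambda>n. ?c n *s orbit M x n) \<longlonglongrightarrow> p" by simp
qed

text \<open>The vector \<open>x\<close> is a multiple of the eigenvector, so its projective orbit is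
  constant.\<close>

lemma orbit_eigenvector:
  assumes q: "M *v q = m *s q" "q \<noteq> 0" and m: "det M \<noteq> 0" and x: "x \<noteq> 0" "det2 x q = 0"
  shows "limitin P1C (\<lambda>n. proj_point (orbit M x n)) (proj_point q) sequentially"
proof -
  obtain c where c: "x = c *s q" using det2_zero_iff[OF q(2)] x(2) by blast
  have "orbit M x n = (c * m ^ n) *s q" for n
    using orbit_eigenbasis[OF q(1) q(1), of c 0 n] c by simp
  then have "proj_point (orbit M x n) = proj_point q" for n
    by (subst proj_point_eq_iff) (use orbit_nonzero[OF m x(1)] q in auto)
  then show ?thesis by (cases "proj_point q") (simp_all add: limitin_const_iff)
qed

text \<open>For \<open>g \<noteq> 0\<close> the coefficient of \<open>p\<close> outgrows that of
  \<open>x\<close> by a factor of order \<open>n\<close>; for \<open>g = 0\<close> the vector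
  already lies on the line of \<open>p\<close>.\<close>

lemma orbit_jordan_limit:
  assumes p: "M *v p = l *s p" "p \<noteq> 0" and M: "det M \<noteq> 0" and x: "x \<noteq> 0"
    and g: "M *v x = l *s x + g *s p" "g = 0 \<longrightarrow> det2 x p = 0"
  shows "limitin P1C (\<lambda>n. proj_point (orbit M x n)) (proj_point p) sequentially"
proof (cases "g = 0")
  case True
  then show ?thesis using orbit_eigenvector[OF p M x] g by simp
next
  case False
  have l0: "l \<noteq> 0"
    using p orbit_nonzero[OF M p(2), of 1] by auto
  \<comment> \<open>The numerator \<open>l\<close> matches the factor on the left of
    \<open>orbit_jordan\<close>. Division by zero makes the value at \<open>n = 0\<close> equal to
    0, hence the restriction to \<open>n > 0\<close> below.\<close>
  let ?c = "\<lambda>n. l / (of_nat n * l ^ n * g)"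
  show ?thesis
  proof (rule limitin_P1C_rescaled)
    show "orbit M x n \<noteq> 0" for n by (rule orbit_nonzero[OF M x])
    show "\<forall>\<^sub>F n in sequentially. ?c n \<noteq> 0"
      using eventually_gt_at_top[of 0] by eventually_elim (use l0 False in auto)
    have eq: "\<forall>\<^sub>F n in sequentially. ?c n *s orbit M x n = ((l / g) * inverse (of_nat n)) *s x + p"
      using eventually_gt_at_top[of 0]
    proof eventually_elim
      case (elim n)
      have "?c n *s orbit M x n = (1 / (of_nat n * l ^ n * g)) *s (l *s orbit M x n)"
        by simp
      also have "\<dots> = ((l / g) * inverse (of_nat n)) *s x + p"
        unfolding orbit_jordan[OF p(1) g(1)]
        using elim l0 False by (simp add: vec2_eq_iff field_simps)
      finally show ?case .
    qed
    have "(\<lambda>n. ((l / g) * inverse (of_nat n)) * x $ i + p $ i) \<longlonglongrightarrow> ((l / g) * 0) * x $ i + p $ i" for i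
      by (intro tendsto_intros lim_inverse_n)
    then have "(\<lambda>n. ((l / g) * inverse (of_nat n)) *s x + p) \<longlonglongrightarrow> p"
      by (intro vec_tendstoI) simp
    then show "(\<lambda>n. ?c n *s orbit M x n) \<longlonglongrightarrow> p"
      using filterlim_cong[OF refl refl eq] by simp
  qed (rule p)
qed

lemma orbit_bounded:
  assumes pq: "M *v p = l *s p" "M *v q = m *s q" "det2 p q \<noteq> 0"
    and lm: "cmod l = 1" "cmod m = 1"
  obtains K where "\<And>n. norm1 (orbit M x n) \<le> K"
proof -
  define a b where "a = det2 x q / det2 p q" and "b = det2 p x / det2 p q"
  have xab: "x = a *s p + b *s q"
    unfolding a_def b_def by (rule det2_decompose[OF pq(3)])
  have "norm1 (orbit M x n) \<le> cmod a * norm1 p + cmod b * norm1 q" for n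
    unfolding xab orbit_eigenbasis[OF pq(1,2)]
    by (rule order_trans[OF norm1_triangle]) (simp add: norm1_scale norm_mult norm_power lm)
  then show ?thesis by (rule that)
qed

section \<open>Counting on a cycle and gluing residue classes\<close>

lemma sum_cyclic_shift:
  fixes f :: "nat \<Rightarrow> nat"
  shows "(\<Sum>j=1..k. f (Suc j)) + f 1 = (\<Sum>j=1..k. f j) + f (Suc k)"
  by (induction k) simp_all

text \<open>Double counting over the \<open>k\<close> cyclically adjacent pairs: each index
  satisfying \<open>Q\<close> is counted twice, and each pair contributes at most 1. In the equality
  case every pair contributes exactly 1, so \<open>Q\<close> alternates.\<close>

lemma cyclic_nonadjacent_card:
  assumes "k \<ge> 1" and per: "\<And>j. Q (j + k) \<longleftrightarrow> Q j" and nonadj: "\<And>j. \<not> (Q j \<and> Q (Suc j))"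
  shows "2 * card {j \<in> {1..k}. Q j} \<le> k"
    and "2 * card {j \<in> {1..k}. Q j} = k \<Longrightarrow> j \<ge> 1 \<Longrightarrow> Q (Suc j) \<longleftrightarrow> \<not> Q j"
proof -
  let ?f = "\<lambda>j. of_bool (Q j) :: nat"
  have card: "card {j \<in> {1..k}. Q j} = (\<Sum>j=1..k. ?f j)"
    by (simp add: of_bool_def sum.If_cases Int_def)
  have "(\<Sum>j=1..k. ?f (Suc j)) = (\<Sum>j=1..k. ?f j)"
    using sum_cyclic_shift[of ?f k] per[of 1] by simp
  then have eq: "2 * card {j \<in> {1..k}. Q j} = (\<Sum>j=1..k. ?f j + ?f (Suc j))"
    unfolding card sum.distrib by (simp only: mult_2)
  have le: "?f j + ?f (Suc j) \<le> 1" for j using nonadj[of j] by auto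
  show "2 * card {j \<in> {1..k}. Q j} \<le> k"
    unfolding eq using sum_mono[of "{1..k}" "\<lambda>j. ?f j + ?f (Suc j)" "\<lambda>_. 1"] le by simp
  show "Q (Suc j) \<longleftrightarrow> \<not> Q j" if k: "2 * card {j \<in> {1..k}. Q j} = k" and "j \<ge> 1"
    using \<open>j \<ge> 1\<close>
  proof (induction j rule: less_induct)
    case (less j)
    show ?case
    proof (cases "j \<le> k")
      case True
      show ?thesis
      proof (rule ccontr)
        assume "\<not> ?thesis"
        then have "?f j + ?f (Suc j) < 1" using nonadj[of j] by auto
        then have "(\<Sum>j=1..k. ?f j + ?f (Suc j)) < (\<Sum>j=1..k. 1)"
          using True less.prems by (intro sum_strict_mono_ex1 ballI le) auto
        with k eq show False by simp
      qed
    next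
      \<comment> \<open>Indices beyond the first period are reduced by \<open>k\<close>; since
        \<open>j > k\<close>, the reduced index is still at least 1.\<close>
      case False
      then have "Q (Suc (j - k)) \<longleftrightarrow> \<not> Q (j - k)" using \<open>k \<ge> 1\<close> by (intro less.IH) auto
      then show ?thesis using per[of "j - k"] per[of "Suc (j - k)"] False by simp
    qed
  qed
qed

text \<open>Finitely many residue classes cover all large indices and admit a common
  threshold.\<close>

lemma limitin_from_residues:
  fixes k :: nat
  assumes k: "k \<ge> 1" and lim: "\<And>j. j \<in> {1..k} \<Longrightarrow> limitin X (\<lambda>n. f (N + j + n * k)) l sequentially"
  shows "limitin X f l sequentially"
proof -
  have "\<forall>\<^sub>F n in sequentially. f n \<in> U" if U: "openin X U" "l \<in> U" for U
  proof -
    have "\<forall>j\<in>{1..k}. \<forall>\<^sub>F n in sequentially. f (N + j + n * k) \<in> U"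
      using lim U unfolding limitin_def by blast
    then have "\<forall>\<^sub>F n in sequentially. \<forall>j\<in>{1..k}. f (N + j + n * k) \<in> U"
      by (simp add: eventually_ball_finite_distrib)
    then obtain n0 where n0: "\<And>n j. n \<ge> n0 \<Longrightarrow> j \<in> {1..k} \<Longrightarrow> f (N + j + n * k) \<in> U"
      unfolding eventually_sequentially by blast
    have "f m \<in> U" if m: "m \<ge> N + 1 + n0 * k" for m
    proof -
      \<comment> \<open>The classes are numbered \<open>1..k\<close>, not from 0, so the offset is
        \<open>N + 1\<close> and the class of \<open>m\<close> is
        \<open>Suc (r mod k)\<close>.\<close>
      define r where "r = m - (N + 1)"
      have "r div k \<ge> n0" using m k by (simp add: r_def less_eq_div_iff_mult_less_eq)
      moreover have "Suc (r mod k) \<in> {1..k}" using k by (simp add: Suc_leI)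
      moreover have "N + Suc (r mod k) + r div k * k = m"
        using m div_mult_mod_eq[of r k] unfolding r_def by linarith
      ultimately show ?thesis using n0 by metis
    qed
    then show ?thesis unfolding eventually_sequentially by blast
  qed
  moreover have "l \<in> topspace X" using lim[of 1] k by (simp add: limitin_def)
  ultimately show ?thesis by (simp add: limitin_def)
qed

section \<open>Matrices and convergents of a periodic continued fraction\<close>

lemma det_D [simp]: "det (D x) = -1"
  by (simp add: D_def det_2)

lemma D_prod_simps [simp]: "D_prod [] = mat 1" "D_prod (x # xs) = D x ** D_prod xs"
  by (simp_all add: D_prod_def)

lemma D_prod_append: "D_prod (xs @ ys) = D_prod xs ** D_prod ys"
  by (induction xs) (simp_all add: matrix_mul_assoc)

lemma det_D_prod: "det (D_prod xs) = (-1) ^ length xs"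
  by (induction xs) (simp_all add: det_mul)

lemma pcf_matrix_Suc: "pcf_matrix bs as (Suc n) = pcf_matrix bs as n ** D (partial_quotient bs as (Suc n))"
  unfolding pcf_matrix_def by (simp add: D_prod_append)

lemma det_pcf_matrix: "det (pcf_matrix bs as n) \<noteq> 0"
  by (simp add: pcf_matrix_def det_D_prod)

lemma pcf_matrix_preperiod: "pcf_matrix bs as (length bs) = D_prod bs"
proof -
  have "map (partial_quotient bs as) [1..<Suc (length bs)] = bs"
    by (rule nth_equalityI) (simp_all add: partial_quotient_def del: upt_Suc)
  then show ?thesis by (simp add: pcf_matrix_def del: upt_Suc)
qed

lemma pcf_matrix_first_period: "pcf_matrix bs as (length bs + length as) = D_prod bs ** D_prod as"
proof -
  have "map (partial_quotient bs as) [1..<Suc (length bs + length as)] = bs @ as"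
    by (rule nth_equalityI) (auto simp: partial_quotient_def nth_append simp del: upt_Suc)
  then show ?thesis by (simp add: pcf_matrix_def D_prod_append del: upt_Suc)
qed

lemma partial_quotient_periodic:
  "n > length bs \<Longrightarrow> partial_quotient bs as (n + length as) = partial_quotient bs as n"
proof -
  assume "n > length bs"
  then have "n + length as - 1 - length bs = (n - 1 - length bs) + length as" by simp
  then have "(n + length as - 1 - length bs) mod length as = (n - 1 - length bs) mod length as"
    by simp
  then show ?thesis using \<open>n > length bs\<close> unfolding partial_quotient_def by simp
qed

lemma matrix_inv_invertible:
  assumes "invertible A"
  shows "A ** matrix_inv A = mat 1" "matrix_inv A ** A = mat 1"
  using someI_ex[OF assms[unfolded invertible_def]] by (simp_all add: matrix_inv_def)

lemma invertible_D_prod: "invertible (D_prod xs)"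
  by (simp add: invertible_det_nz det_D_prod)

text \<open>For \<open>m = 0\<close> this is EB = BA. Each further step multiplies both sides on the
  right by the same matrix, because the partial quotients past the preperiod repeat.\<close>

lemma pcf_matrix_periodic:
  "pcf_matrix bs as (length bs + m + length as) = pcf_E bs as ** pcf_matrix bs as (length bs + m)"
proof (induction m)
  case 0
  have "pcf_E bs as ** D_prod bs = D_prod bs ** D_prod as ** (matrix_inv (D_prod bs) ** D_prod bs)"
    by (simp add: pcf_E_def matrix_mul_assoc)
  also have "\<dots> = D_prod bs ** D_prod as"
    by (simp add: matrix_inv_invertible[OF invertible_D_prod])
  finally have "pcf_E bs as ** D_prod bs = D_prod bs ** D_prod as" .
  then show ?case
    by (simp add: pcf_matrix_first_period pcf_matrix_preperiod)
next
  case (Suc m)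
  have "partial_quotient bs as (Suc (length bs + m + length as)) = partial_quotient bs as (Suc (length bs + m))"
    using partial_quotient_periodic[of bs "Suc (length bs + m)" as] by simp
  then show ?case
    using Suc by (simp add: pcf_matrix_Suc matrix_mul_assoc)
qed

lemma det_pcf_E: "det (pcf_E bs as) = (-1) ^ length as"
proof -
  have "det (D_prod bs) * det (matrix_inv (D_prod bs)) = 1"
    by (metis det_I det_mul invertible_D_prod matrix_inv_invertible(1))
  then show ?thesis by (simp add: pcf_E_def det_mul det_D_prod mult.commute mult.left_commute)
qed

text \<open>Homogeneous coordinates of a convergent, indexed from the end of the preperiod so that
  \<open>pcf_E\<close> acts as the shift by one period.\<close>

definition pcf_vec :: "complex list \<Rightarrow> complex list \<Rightarrow> nat \<Rightarrow> complex^2" where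
  "pcf_vec bs as j = column 1 (pcf_matrix bs as (length bs + j))"

lemma convergent_of_pcf_vec: "convergent_of bs as (length bs + j) = proj_point (pcf_vec bs as j)"
  by (simp add: convergent_of_def proj_point_def pcf_vec_def column_def)

lemma column_matrix_mult: "column i (A ** B) = A *v column i B" for A :: "complex^2^2"
  by (simp add: column_def matrix_matrix_mult_def matrix_vector_mult_def vec_eq_iff)

lemma pcf_vec_periodic: "pcf_E bs as *v pcf_vec bs as j = pcf_vec bs as (j + length as)"
  using pcf_matrix_periodic[of bs as j] by (simp add: pcf_vec_def column_matrix_mult add.assoc)

lemma orbit_pcf_vec: "orbit (pcf_E bs as) (pcf_vec bs as j) n = pcf_vec bs as (j + n * length as)"
  by (induction n) (simp_all add: pcf_vec_periodic algebra_simps)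

text \<open>Right multiplication by a matrix \<open>D x\<close> moves the first column into the
  second, so the two vectors are the columns of a single invertible matrix.\<close>

lemma det2_pcf_vec: "det2 (pcf_vec bs as (Suc j)) (pcf_vec bs as j) \<noteq> 0"
proof -
  have "det2 (pcf_vec bs as (Suc j)) (pcf_vec bs as j) = det (pcf_matrix bs as (length bs + Suc j))"
    by (simp add: pcf_vec_def column_def det2_def det_2 pcf_matrix_Suc matrix_matrix_mult_def sum_2 D_def)
  then show ?thesis using det_pcf_matrix by simp
qed

lemma pcf_vec_nonzero: "pcf_vec bs as j \<noteq> 0"
  using det2_pcf_vec[of bs as j] by auto

text \<open>The classical three-term recurrence of numerators and denominators, in vector
  form.\<close>

lemma pcf_vec_recurrence:
  obtains c where "pcf_vec bs as (Suc (Suc j)) = c *s pcf_vec bs as (Suc j) + pcf_vec bs as j"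
proof
  show "pcf_vec bs as (Suc (Suc j)) =
    partial_quotient bs as (length bs + Suc (Suc j)) *s pcf_vec bs as (Suc j) + pcf_vec bs as j"
    by (simp add: vec2_eq_iff pcf_vec_def column_def pcf_matrix_Suc matrix_matrix_mult_def sum_2 D_def)
qed

section \<open>Unequal moduli and divergence give a strict majority\<close>

text \<open>Indices whose vector lies on the repelling line of \<open>q\<close> have the limit
  \<open>q\<close>, all others the limit \<open>p\<close>. Non-adjacency bounds the first kind by
  half, the determinant excludes exactly half, and divergence excludes that there are none.\<close>

lemma dominant_eigenvalue_majority_limits:
  assumes k: "length as = k" "k \<ge> 1"
    and p: "p \<noteq> 0" "pcf_E bs as *v p = l *s p" and q: "q \<noteq> 0" "pcf_E bs as *v q = m *s q"
    and ml: "cmod m < cmod l" and not_conv: "\<not> pcf_converges bs as"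
  shows "\<exists>Phat v. (\<forall>j. limitin P1C (\<lambda>n. convergent_of bs as (length bs + j + n * k)) (Phat j) sequentially) \<and>
    2 * card {j \<in> {1..k}. Phat j = v} > k \<and> \<not> (\<forall>j\<in>{1..k}. Phat j = v)"
proof -
  define Phat where "Phat j = (if det2 (pcf_vec bs as j) q = 0 then proj_point q else proj_point p)" for j
  let ?E = "pcf_E bs as" and ?v = "pcf_vec bs as"
  have pq: "det2 p q \<noteq> 0"
    using eigenvectors_independent[OF p(2) q(2) p(1) q(1)] ml by auto
  have detE: "l * m = (-1) ^ k"
    using det_eigenbasis[OF p(2) q(2) pq] det_pcf_E k(1) by metis
  then have m0: "m \<noteq> 0" by (metis mult_zero_right power_not_zero zero_neq_neg_one)
  have E0: "det ?E \<noteq> 0" by (simp add: det_pcf_E)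
  have pq': "proj_point p \<noteq> proj_point q"
    using pq proj_point_eq_iff p(1) q(1) by blast
  have lim: "limitin P1C (\<lambda>n. convergent_of bs as (length bs + j + n * k)) (Phat j) sequentially" for j
  proof -
    have "limitin P1C (\<lambda>n. proj_point (orbit ?E (?v j) n)) (Phat j) sequentially"
      unfolding Phat_def
      using orbit_attracted[OF p(2) q(2) pq ml m0] orbit_eigenvector[OF q(2,1) E0 pcf_vec_nonzero] by auto
    then show ?thesis
      by (simp add: orbit_pcf_vec convergent_of_pcf_vec k add.assoc)
  qed
  define Q where "Q j \<longleftrightarrow> det2 (?v j) q = 0" for j
  have per: "Q (j + k) \<longleftrightarrow> Q j" for j
  proof -
    have "m * det2 (?v (j + k)) q = det2 (?E *v ?v j) (?E *v q)"
      by (simp add: pcf_vec_periodic k q)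
    then show ?thesis using E0 m0 unfolding det2_matrix Q_def by (metis mult_eq_0_iff)
  qed
  have nonadj: "\<not> (Q j \<and> Q (Suc j))" for j
  proof
    assume "Q j \<and> Q (Suc j)"
    then obtain a b where "?v j = a *s q" "?v (Suc j) = b *s q"
      unfolding Q_def det2_zero_iff[OF q(1)] by blast
    then show False using det2_pcf_vec[of bs as j] by simp
  qed
  have "2 * card {j \<in> {1..k}. Q j} \<noteq> k"
  proof
    assume eq: "2 * card {j \<in> {1..k}. Q j} = k"
    then have "{j \<in> {1..k}. Q j} \<noteq> {}" using k(2) by (auto simp del: Collect_empty_eq)
    then obtain j0 where j0: "j0 \<ge> 1" "Q j0" by auto
    \<comment> \<open>With exactly half, every second vector lies on the line of \<open>q\<close>;
      the recurrence shows that these vectors are even equal.\<close>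
    have "?v (j0 + 2 * i) = ?v j0" for i
    proof (induction i)
      case (Suc i)
      define j where "j = j0 + 2 * i"
      have Qj: "Q j" using Suc j0 by (simp add: Q_def j_def)
      have alt: "Q (Suc j) \<longleftrightarrow> \<not> Q j" "Q (Suc (Suc j)) \<longleftrightarrow> \<not> Q (Suc j)"
        using j0 by (intro cyclic_nonadjacent_card(2)[OF k(2) per nonadj eq]; simp add: j_def)+
      obtain c where c: "?v (Suc (Suc j)) = c *s ?v (Suc j) + ?v j" by (rule pcf_vec_recurrence)
      \<comment> \<open>The outer vectors of the recurrence are parallel to \<open>q\<close> and the
        middle one is not, so pairing with \<open>q\<close> isolates \<open>c\<close>.\<close>
      have "c * det2 (?v (Suc j)) q = 0"
        using arg_cong[OF c, of "\<lambda>x. det2 x q"] alt Qj by (simp add: Q_def)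
      then have "c = 0" using alt Qj by (simp add: Q_def)
      then show ?case using c Suc by (simp add: j_def)
    qed simp
    \<comment> \<open>Twice this cardinality is \<open>k\<close>, so the choice of \<open>i\<close>
      moves by exactly one period.\<close>
    from this[of "card {j \<in> {1..k}. Q j}"] have "?v (j0 + k) = ?v j0" unfolding eq .
    then have fixed: "?E *v ?v j0 = ?v j0" by (simp add: pcf_vec_periodic k)
    obtain a where a: "?v j0 = a *s q" using j0(2) unfolding Q_def det2_zero_iff[OF q(1)] by blast
    then have "a *s (m *s q) = a *s q" using fixed q(2) by (metis vec.scale)
    moreover have "a \<noteq> 0" using a pcf_vec_nonzero[of bs as j0] by auto
    ultimately have "m = 1" using q(1) by auto
    \<comment> \<open>For even \<open>k\<close> the determinant is 1, so \<open>l = 1\<close>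
      follows from \<open>m = 1\<close>, against \<open>ml\<close>.\<close>
    moreover have "even k" using eq by (metis dvd_triv_left)
    then have "l * m = 1" using detE by simp
    ultimately show False using ml by simp
  qed
  then have card: "2 * card {j \<in> {1..k}. Q j} < k"
    using cyclic_nonadjacent_card(1)[OF k(2) per nonadj] by simp
  have "{j \<in> {1..k}. Phat j = proj_point p} = {1..k} - {j \<in> {1..k}. Q j}"
    using pq' by (auto simp: Phat_def Q_def)
  moreover have "card ({1..k} - {j \<in> {1..k}. Q j}) = card {1..k} - card {j \<in> {1..k}. Q j}"
    by (rule card_Diff_subset) auto
  ultimately have "card {j \<in> {1..k}. Phat j = proj_point p} = k - card {j \<in> {1..k}. Q j}"
    by (simp only: card_atLeastAtMost)
  with card have majority: "2 * card {j \<in> {1..k}. Phat j = proj_point p} > k"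
    by linarith
  have notall: "\<not> (\<forall>j\<in>{1..k}. Phat j = proj_point p)"
  proof
    assume all: "\<forall>j\<in>{1..k}. Phat j = proj_point p"
    have "limitin P1C (convergent_of bs as) (proj_point p) sequentially"
    proof (rule limitin_from_residues[OF k(2)])
      fix j assume "j \<in> {1..k}"
      then have "Phat j = proj_point p" using all by blast
      with lim[of j] show "limitin P1C (\<lambda>n. convergent_of bs as (length bs + j + n * k)) (proj_point p) sequentially"
        by (simp only:)
    qed
    with not_conv show False by (auto simp: pcf_converges_def)
  qed
  show ?thesis using lim majority notall by blast
qed

section \<open>A strict majority gives unequal moduli\<close>

text \<open>The majority provides two adjacent, hence independent, vectors whose orbits share the
  limit \<open>x\<close>. For a diagonalizable matrix with equal moduli
  \<open>no_common_limit\<close> forbids this; a Jordan block would make all limits equal.\<close>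

lemma majority_limits_eigenvalues:
  assumes k: "length as = k" "k \<ge> 1"
    and lim: "\<And>j. j \<in> {1..k} \<Longrightarrow>
      limitin P1C (\<lambda>n. convergent_of bs as (length bs + j + n * k)) (Phat j) sequentially"
    and maj: "2 * card {j \<in> {1..k}. Phat j = x} > k" and notall: "\<not> (\<forall>j\<in>{1..k}. Phat j = x)"
  shows "\<exists>z w. is_eigenvalue (pcf_E bs as) z \<and> is_eigenvalue (pcf_E bs as) w \<and> cmod z \<noteq> cmod w"
proof -
  let ?E = "pcf_E bs as" and ?v = "pcf_vec bs as"
  have E0: "det ?E \<noteq> 0" by (simp add: det_pcf_E)
  have orb: "(\<lambda>n. convergent_of bs as (length bs + j + n * k)) = (\<lambda>n. proj_point (orbit ?E (?v j) n))" for j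
    by (simp add: orbit_pcf_vec convergent_of_pcf_vec k add.assoc)
  \<comment> \<open>\<open>Phat\<close> is constrained only on \<open>1..k\<close>. Stating the
    property through the limit itself extends it periodically to all indices, including the
    wrap-around pair \<open>k\<close>, \<open>Suc k\<close>.\<close>
  define R where "R j \<longleftrightarrow> limitin P1C (\<lambda>n. proj_point (orbit ?E (?v j) n)) x sequentially" for j
  have per: "R (j + k) \<longleftrightarrow> R j" for j
  proof -
    have "orbit ?E (?v (j + k)) n = orbit ?E (?v j) (n + 1)" for n
      by (simp add: orbit_pcf_vec k algebra_simps del: orbit_Suc)
    then show ?thesis
      unfolding R_def
      using limitin_sequentially_offset[of P1C "\<lambda>n. proj_point (orbit ?E (?v j) n)" x 1]
        limitin_sequentially_offset_rev[of P1C "\<lambda>n. proj_point (orbit ?E (?v j) n)" 1 x] by auto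
  qed
  have "card {j \<in> {1..k}. Phat j = x} \<le> card {j \<in> {1..k}. R j}"
    using lim by (intro card_mono) (auto simp: R_def orb)
  with maj have "\<not> 2 * card {j \<in> {1..k}. R j} \<le> k" by simp
  \<comment> \<open>Without such a pair the counting bound would apply to \<open>R\<close>.\<close>
  then obtain j where j: "R j" "R (Suc j)"
    using cyclic_nonadjacent_card(1)[OF k(2), of R] per by blast
  show ?thesis
  proof (cases ?E rule: jordan_form_2)
    case (diagonalizable p q l m)
    have "cmod l \<noteq> cmod m"
    proof
      assume eq: "cmod l = cmod m"
      \<comment> \<open>The determinant has modulus 1, so equal moduli must both be 1 and the orbits
        are bounded.\<close>
      have "l * m = (-1) ^ k"
        using det_eigenbasis[OF diagonalizable(2,3,1)] det_pcf_E k(1) by metis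
      then have "cmod l * cmod m = 1" by (metis norm_mult norm_power norm_minus_cancel norm_one power_one)
      then have "(cmod m)\<^sup>2 = 1" unfolding eq by (simp add: power2_eq_square)
      then have 1: "cmod l = 1" "cmod m = 1" using eq by (simp_all add: power2_eq_1_iff)
           (use norm_ge_zero[of m] in linarith)+
      obtain K1 where K1: "\<And>n. norm1 (orbit ?E (?v (Suc j)) n) \<le> K1"
        using orbit_bounded[OF diagonalizable(2,3,1) 1] by blast
      obtain K2 where K2: "\<And>n. norm1 (orbit ?E (?v j) n) \<le> K2"
        using orbit_bounded[OF diagonalizable(2,3,1) 1] by blast
      show False
      proof (rule no_common_limit)
        show "norm1 (orbit ?E (?v (Suc j)) n) \<le> max K1 K2" "norm1 (orbit ?E (?v j) n) \<le> max K1 K2" for n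
          using K1[of n] K2[of n] by auto
        show "cmod (det2 (orbit ?E (?v (Suc j)) n) (orbit ?E (?v j) n)) = cmod (det2 (?v (Suc j)) (?v j))" for n
          by (simp add: det2_orbit det_pcf_E norm_mult norm_power)
        show "cmod (det2 (?v (Suc j)) (?v j)) > 0" using det2_pcf_vec by simp
      qed (use j in \<open>simp_all add: R_def\<close>)
    qed
    moreover have "p \<noteq> 0" "q \<noteq> 0" using diagonalizable(1) by auto
    ultimately show ?thesis using diagonalizable unfolding is_eigenvalue_def by blast
  next
    case (jordan p l)
    \<comment> \<open>Every orbit tends to the only eigenline; since some limit equals
      \<open>x\<close>, the common value is \<open>x\<close>.\<close>
    have "Phat j = proj_point p" if "j \<in> {1..k}" for j
    proof -
      obtain g where "?E *v ?v j = l *s ?v j + g *s p" "g = 0 \<longrightarrow> det2 (?v j) p = 0"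
        using jordan(3) by blast
      then have "limitin P1C (\<lambda>n. proj_point (orbit ?E (?v j) n)) (proj_point p) sequentially"
        by (rule orbit_jordan_limit[OF jordan(2,1) E0 pcf_vec_nonzero])
      with lim[OF that] show ?thesis
        unfolding orb by (rule limitin_Hausdorff_unique) (simp_all add: Hausdorff_space_P1C)
    qed
    moreover from maj have "{j \<in> {1..k}. Phat j = x} \<noteq> {}" by (auto simp del: Collect_empty_eq)
    ultimately have "\<forall>j\<in>{1..k}. Phat j = x" by auto
    with notall show ?thesis ..
  qed
qed

theorem theorem7p8:
  fixes N k :: nat and bs as :: "complex list"
  assumes "length bs = N" and "length as = k" and "k \<ge> 1"
  shows "strictly_quasiconvergent bs as \<longleftrightarrow>
    (\<exists>Phat :: nat \<Rightarrow> complex option.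
       (\<forall>j\<in>{1..k}. limitin P1C (\<lambda>n. convergent_of bs as (N + j + n * k)) (Phat j) sequentially) \<and>
       (\<exists>v. real (card {j\<in>{1..k}. Phat j = v}) > real k / 2 \<and> \<not> (\<forall>j\<in>{1..k}. Phat j = v)))"
    (is "?L \<longleftrightarrow> ?R")
proof
  assume ?L
  then obtain z w p q where *: "p \<noteq> 0" "pcf_E bs as *v p = z *s p" "q \<noteq> 0" "pcf_E bs as *v q = w *s q"
    "cmod z \<noteq> cmod w" "\<not> pcf_converges bs as"
    unfolding strictly_quasiconvergent_def is_eigenvalue_def by blast
  have "\<exists>Phat v. (\<forall>j. limitin P1C (\<lambda>n. convergent_of bs as (length bs + j + n * k)) (Phat j) sequentially) \<and>
     2 * card {j \<in> {1..k}. Phat j = v} > k \<and> \<not> (\<forall>j\<in>{1..k}. Phat j = v)"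
  \<comment> \<open>Either eigenvalue may be the dominant one; the roles of the eigenvectors are
    swapped accordingly.\<close>
  proof (cases "cmod w < cmod z")
    case True
    then show ?thesis
      by (rule dominant_eigenvalue_majority_limits[OF assms(2,3) *(1-4) _ *(6)])
  next
    case False
    with *(5) have "cmod z < cmod w" by simp
    then show ?thesis
      by (rule dominant_eigenvalue_majority_limits[OF assms(2,3) *(3,4,1,2) _ *(6)])
  qed
  then obtain Phat v where
    "\<forall>j. limitin P1C (\<lambda>n. convergent_of bs as (length bs + j + n * k)) (Phat j) sequentially"
    "2 * card {j \<in> {1..k}. Phat j = v} > k" "\<not> (\<forall>j\<in>{1..k}. Phat j = v)"
    by blast
  then show ?R
    using assms(1) by (intro exI[of _ Phat] conjI exI[of _ v]) auto
next
  assume ?R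
  then obtain Phat v where lim: "\<And>j. j \<in> {1..k} \<Longrightarrow>
      limitin P1C (\<lambda>n. convergent_of bs as (length bs + j + n * k)) (Phat j) sequentially"
    and "real (card {j \<in> {1..k}. Phat j = v}) > real k / 2" and notall: "\<not> (\<forall>j\<in>{1..k}. Phat j = v)"
    using assms(1) by blast
  then have maj: "2 * card {j \<in> {1..k}. Phat j = v} > k" by linarith
  \<comment> \<open>A limit of the whole sequence would be the limit along each residue class, so
    all \<open>Phat j\<close> would agree with the majority value.\<close>
  have "\<not> pcf_converges bs as"
  proof
    assume "pcf_converges bs as"
    then obtain l where l: "limitin P1C (convergent_of bs as) l sequentially"
      by (auto simp: pcf_converges_def)
    have "Phat j = l" if "j \<in> {1..k}" for j
    proof -
      have "strict_mono (\<lambda>n. length bs + j + n * k)"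
        using assms(3) by (intro strict_monoI) simp
      from limitin_subsequence[OF this l] lim[OF that] show ?thesis
        using limitin_Hausdorff_unique Hausdorff_space_P1C
        by (metis (no_types, lifting) comp_def ext trivial_limit_sequentially)
    qed
    moreover from maj have "{j \<in> {1..k}. Phat j = v} \<noteq> {}" by (auto simp del: Collect_empty_eq)
    ultimately have "\<forall>j\<in>{1..k}. Phat j = v" by auto
    with notall show False ..
  qed
  then show ?L
    unfolding strictly_quasiconvergent_def
    using majority_limits_eigenvalues[OF assms(2,3) lim maj notall] by blast
qed

end
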